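(* Let $n\ge1$ be an integer and let $f=[f_0:\dots:f_n]:\mathbb{R}\to\mathbb{TP}^n$ be a tropical holomorphic map (with reduced representation $(f_0,\dots,f_n)$) which is tropically linearly nondegenerate. Let $H_1,\dots,H_q$ be tropical hyperplanes in $\mathbb{TP}^n$ in general position, defined by tropical linear polynomials $P_1,\dots,P_q$ respectively. Then $$\sum_{j=1}^q\delta_f(H_j)\le n+1.$$ Furthermore, $\delta_f(H)=0$ for any tropical hyperplane $H$ defined by a tropical linear polynomial with all coefficients in $\mathbb{R}$.
   Context: Tropical semiring: $\mathbb{T}=\mathbb{R}\cup\{-\infty\}$, $x\oplus y=\max(x,y)$, $x\otimes y=x+y$, $x\oslash y=x-y$, $0_{\mathbb{T}}=-\infty$, $1_{\mathbb{T}}=0$. Tropical projective space $\mathbb{TP}^n$ is $\mathbb{T}^{n+1}\setminus\{(0_{\mathbb{T}},\dots,0_{\mathbb{T}})\}$ modulo $(a_0,\dots,a_n)\sim(\lambda+a_0,\dots,\lambda+a_n)$, $\lambda\in\mathbb{R}$. Hyperplanes: a tropical linear polynomial is $P(x)=\max_{0\le i\le n}(a_i+x_i)$ with coefficient vector $a=(a_0,\dots,a_n)\in\mathbb{T}^{n+1}$ not all $0_{\mathbb{T}}$. The tropical hyperplane it defines is $H=\{x\in\mathbb{TP}^n:\ \max_i(a_i+x_i)\text{ is attained for at least two indices } i\}$ (in particular $x\in H$ if all terms are $-\infty$). $H_1,\dots,H_q$ are in general position if $H_{\mu(0)}\cap\dots\cap H_{\mu(n)}=\varnothing$ for every injective map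 $\mu:\{0,\dots,n\}\to\{1,\dots,q\}$. Functions: a tropical meromorphic function is a continuous piecewise linear $g:\mathbb{R}\to\mathbb{R}$ (real slopes, finitely many non-differentiability points in each bounded interval). Put $\omega_g(x)=\lim_{\varepsilon\to0^+}(g'(x+\varepsilon)-g'(x-\varepsilon))$; $x$ is a root of multiplicity $\omega_g(x)$ if $\omega_g(x)>0$, and a pole of multiplicity $-\omega_g(x)$ if $\omega_g(x)<0$. A tropical entire function is a tropical meromorphic function without poles. The counting function is $N(r,g)=\frac12\int_0^r n(t,g)\,dt$ with $n(t,g)=\sum_{|s|\le t,\ \omega_g(s)<0}|\omega_g(s)|$ (poles); thus $N(r,1_{\mathbb{T}}\oslash g)=N(r,-g)$ counts the roots of $g$. Curves: a tropical holomorphic map (curve) $f=[f_0:\dots:f_n]:\mathbb{R}\to\mathbb{TP}^n$ is given by tropical entire functions $f_0,\dots,f_n$ having no common root (reduced representation). Put $\|f(x)\|=\max_i f_i(x)$, $T_f(r)=\frac12(\|f(r)\|+\|f(-r)\|)-\|f(0)\|$, and $P\circ f=\max_i(a_i+f_i)$. The map $f$ is tropically linearly nondegenerate if $f(\mathbb{R})$ is not contained in any tropical hyperplane of $\mathbb{TP}^n$. Proximity function and defect: for $H$ defined by $P$ with coefficient vector $a$, $\|a\|=\max_i a_i$, put $\lambda_H(f(x))=\|f(x)\|+\|a\|-P\circ f(x)$ and $m_f(r,H)=\frac12\sum_{\sigma=\pm1}\lambda_H(f(\sigma r))$. The defect is $$\delta_f(H)=\liminf_{r\to\infty}\frac{m_f(r,H)}{T_f(r)}=1-\limsup_{r\to\infty}\frac{N(r,1_{\mathbb{T}}\oslash(P\circ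 f))}{T_f(r)}.$$ *)

theory Defs
  imports "HOL-Analysis.Analysis"
begin

text \<open>
  The tropical semiring is the part of \<^typ>\<open>ereal\<close> different from \<open>\<infinity>\<close>: tropical addition is \<open>max\<close>,
  tropical multiplication is \<open>+\<close>, and tropical zero and one are \<open>-\<infinity>\<close> and \<open>0\<close>. Vectors of length
  \<open>n + 1\<close> are functions on \<open>nat\<close> of which only the values at \<open>0, \<dots>, n\<close> matter.
\<close>

definition trop_nonzero :: "nat \<Rightarrow> (nat \<Rightarrow> ereal) \<Rightarrow> bool" where
  "trop_nonzero n a \<longleftrightarrow> (\<forall>i\<le>n. a i \<noteq> \<infinity>) \<and> (\<exists>i\<le>n. a i \<noteq> -\<infinity>)"

definition max_coord :: "nat \<Rightarrow> (nat \<Rightarrow> 'a::linorder) \<Rightarrow> 'a" where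
  "max_coord n v = Max (v ` {..n})"

definition trop_rel :: "nat \<Rightarrow> ((nat \<Rightarrow> ereal) \<times> (nat \<Rightarrow> ereal)) set" where
  "trop_rel n = {(x, y). x \<in> extensional {..n} \<and> y \<in> extensional {..n} \<and>
     trop_nonzero n x \<and> trop_nonzero n y \<and> (\<exists>c::real. \<forall>i\<le>n. y i = ereal c + x i)}"

definition trop_proj :: "nat \<Rightarrow> (nat \<Rightarrow> ereal) set set" where
  "trop_proj n = {x \<in> extensional {..n}. trop_nonzero n x} // trop_rel n"

lemma equiv_trop_rel: "equiv {x \<in> extensional {..n}. trop_nonzero n x} (trop_rel n)"
proof (rule equivI)
  show "trop_rel n \<subseteq> {x \<in> extensional {..n}. trop_nonzero n x} \<times>
      {x \<in> extensional {..n}. trop_nonzero n x}"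
    by (auto simp: trop_rel_def)
  show "refl_on {x \<in> extensional {..n}. trop_nonzero n x} (trop_rel n)"
    by (auto simp: refl_on_def trop_rel_def intro!: exI[of _ 0] simp flip: zero_ereal_def)
  show "sym (trop_rel n)"
  proof (rule symI)
    fix x y assume "(x, y) \<in> trop_rel n"
    then obtain c :: real where xy: "x \<in> extensional {..n}" "y \<in> extensional {..n}"
      "trop_nonzero n x" "trop_nonzero n y" "\<forall>i\<le>n. y i = ereal c + x i"
      by (auto simp: trop_rel_def)
    have "\<forall>i\<le>n. x i = ereal (- c) + y i"
    proof (intro allI impI)
      fix i assume "i \<le> n"
      with xy(5) show "x i = ereal (- c) + y i" by (cases "x i") auto
    qed
    with xy show "(y, x) \<in> trop_rel n" unfolding trop_rel_def by blast
  qed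
  show "trans (trop_rel n)"
  proof (rule transI)
    fix x y z assume "(x, y) \<in> trop_rel n" "(y, z) \<in> trop_rel n"
    then obtain c d :: real where xyz: "x \<in> extensional {..n}" "z \<in> extensional {..n}"
      "trop_nonzero n x" "trop_nonzero n z"
      "\<forall>i\<le>n. y i = ereal c + x i" "\<forall>i\<le>n. z i = ereal d + y i"
      unfolding trop_rel_def by blast
    have "\<forall>i\<le>n. z i = ereal (d + c) + x i"
    proof (intro allI impI)
      fix i assume "i \<le> n"
      with xyz(5,6) show "z i = ereal (d + c) + x i" by (cases "x i") auto
    qed
    with xyz show "(x, z) \<in> trop_rel n" unfolding trop_rel_def by blast
  qed
qed

definition trop_linear :: "nat \<Rightarrow> (nat \<Rightarrow> ereal) \<Rightarrow> (nat \<Rightarrow> ereal) \<Rightarrow> ereal" where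
  "trop_linear n a x = max_coord n (\<lambda>i. a i + x i)"

definition attained_twice :: "nat \<Rightarrow> (nat \<Rightarrow> ereal) \<Rightarrow> (nat \<Rightarrow> ereal) \<Rightarrow> bool" where
  "attained_twice n a x \<longleftrightarrow> (\<exists>i\<le>n. \<exists>j\<le>n. i \<noteq> j \<and>
     a i + x i = trop_linear n a x \<and> a j + x j = trop_linear n a x)"

lemma attained_twice_iff:
  "attained_twice n a x \<longleftrightarrow> (\<exists>i\<le>n. \<exists>j\<le>n. i \<noteq> j \<and>
     (\<forall>k\<le>n. a k + x k \<le> a i + x i) \<and> (\<forall>k\<le>n. a k + x k \<le> a j + x j))"
proof -
  have "a i + x i = trop_linear n a x \<longleftrightarrow> (\<forall>k\<le>n. a k + x k \<le> a i + x i)" if "i \<le> n" for i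
    using that unfolding trop_linear_def max_coord_def
    by (subst eq_commute, subst Max_eq_iff) auto
  then show ?thesis unfolding attained_twice_def by blast
qed

text \<open>Hence it does not matter which representative is tested for membership in a hyperplane.\<close>

lemma attained_twice_trop_rel:
  assumes "(x, y) \<in> trop_rel n"
  shows "attained_twice n a x \<longleftrightarrow> attained_twice n a y"
proof -
  from assms obtain c :: real where c: "\<forall>i\<le>n. y i = ereal c + x i"
    by (auto simp: trop_rel_def)
  have "a k + y k \<le> a i + y i \<longleftrightarrow> a k + x k \<le> a i + x i" if "i \<le> n" "k \<le> n" for i k
  proof -
    have "a k + y k = ereal c + (a k + x k)" "a i + y i = ereal c + (a i + x i)"
      using c that by (simp_all add: add.left_commute)
    then show ?thesis by (simp add: ereal_add_le_add_iff)
  qed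
  then show ?thesis unfolding attained_twice_iff by blast
qed

definition trop_hyperplane :: "nat \<Rightarrow> (nat \<Rightarrow> ereal) \<Rightarrow> (nat \<Rightarrow> ereal) set set" where
  "trop_hyperplane n a = {X \<in> trop_proj n. \<exists>x\<in>X. attained_twice n a x}"

definition general_position :: "nat \<Rightarrow> nat \<Rightarrow> (nat \<Rightarrow> (nat \<Rightarrow> ereal) set set) \<Rightarrow> bool" where
  "general_position n q H \<longleftrightarrow>
     (\<forall>\<mu>. inj_on \<mu> {0..n} \<and> \<mu> ` {0..n} \<subseteq> {1..q} \<longrightarrow> (\<Inter>i\<in>{0..n}. H (\<mu> i)) = {})"

text \<open>The last conjunct says that \<open>g\<close> is affine between consecutive points of non-differentiability.\<close>

definition trop_meromorphic :: "(real \<Rightarrow> real) \<Rightarrow> bool" where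
  "trop_meromorphic g \<longleftrightarrow> continuous_on UNIV g \<and>
     (\<forall>a b. finite {x \<in> {a..b}. \<not> g differentiable (at x)}) \<and>
     (\<forall>a b. (\<forall>x\<in>{a<..<b}. g differentiable (at x)) \<longrightarrow>
        (\<exists>s c. \<forall>x\<in>{a<..<b}. g x = s * x + c))"

definition trop_omega :: "(real \<Rightarrow> real) \<Rightarrow> real \<Rightarrow> real" where
  "trop_omega g x = Lim (at_right 0) (\<lambda>e. deriv g (x + e) - deriv g (x - e))"

definition trop_entire :: "(real \<Rightarrow> real) \<Rightarrow> bool" where
  "trop_entire g \<longleftrightarrow> trop_meromorphic g \<and> \<not> (\<exists>x. trop_omega g x < 0)"

definition reduced_representation :: "nat \<Rightarrow> (nat \<Rightarrow> real \<Rightarrow> real) \<Rightarrow> bool" where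
  "reduced_representation n f \<longleftrightarrow>
     (\<forall>i\<le>n. trop_entire (f i)) \<and> \<not> (\<exists>x. \<forall>i\<le>n. trop_omega (f i) x > 0)"

definition trop_curve :: "nat \<Rightarrow> (nat \<Rightarrow> real \<Rightarrow> real) \<Rightarrow> real \<Rightarrow> (nat \<Rightarrow> ereal) set" where
  "trop_curve n f x = trop_rel n `` {\<lambda>i\<in>{..n}. ereal (f i x)}"

lemma trop_curve_in_trop_proj: "trop_curve n f x \<in> trop_proj n"
  unfolding trop_curve_def trop_proj_def
  by (rule quotientI) (auto simp: trop_nonzero_def)

definition trop_nondegenerate :: "nat \<Rightarrow> (nat \<Rightarrow> real \<Rightarrow> real) \<Rightarrow> bool" where
  "trop_nondegenerate n f \<longleftrightarrow>
     (\<forall>a. trop_nonzero n a \<longrightarrow> \<not> range (trop_curve n f) \<subseteq> trop_hyperplane n a)"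

definition curve_norm :: "nat \<Rightarrow> (nat \<Rightarrow> real \<Rightarrow> real) \<Rightarrow> real \<Rightarrow> real" where
  "curve_norm n f x = max_coord n (\<lambda>i. f i x)"

definition trop_char :: "nat \<Rightarrow> (nat \<Rightarrow> real \<Rightarrow> real) \<Rightarrow> real \<Rightarrow> real" where
  "trop_char n f r = (curve_norm n f r + curve_norm n f (- r)) / 2 - curve_norm n f 0"

text \<open>
  The Weil function, the proximity function and the defect of the hyperplane with coefficient
  vector \<open>a\<close>; none of them changes if a real constant is added to all coefficients.
\<close>

definition weil_fun :: "nat \<Rightarrow> (nat \<Rightarrow> real \<Rightarrow> real) \<Rightarrow> (nat \<Rightarrow> ereal) \<Rightarrow> real \<Rightarrow> ereal" where
  "weil_fun n f a x =
     ereal (curve_norm n f x) + max_coord n a - trop_linear n a (\<lambda>i. ereal (f i x))"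

definition trop_proximity :: "nat \<Rightarrow> (nat \<Rightarrow> real \<Rightarrow> real) \<Rightarrow> (nat \<Rightarrow> ereal) \<Rightarrow> real \<Rightarrow> ereal" where
  "trop_proximity n f a r = (weil_fun n f a r + weil_fun n f a (- r)) / 2"

definition trop_defect :: "nat \<Rightarrow> (nat \<Rightarrow> real \<Rightarrow> real) \<Rightarrow> (nat \<Rightarrow> ereal) \<Rightarrow> ereal" where
  "trop_defect n f a = Liminf at_top (\<lambda>r::real. trop_proximity n f a r / ereal (trop_char n f r))"

end

theory Submission imports Defs begin

text \<open>
  Write \<open>u\<close> for \<open>\<parallel>f\<parallel>\<close>, the maximum of the \<open>f\<^sub>i\<close>, and \<open>T\<close> for the characteristic function. The
  statement follows from a pointwise bound for the Weil functions, averaged over \<open>r\<close> and \<open>- r\<close>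
  and divided by \<open>T r\<close>.

  If the coefficient \<open>a\<^sub>i\<close> of a hyperplane is finite, its Weil function is at most
  \<open>u - f\<^sub>i + O(1)\<close>, since \<open>a\<^sub>i + f\<^sub>i\<close> is one of the terms whose maximum is subtracted. Let more than
  \<open>n\<close> hyperplanes be in general position. Then any \<open>n + 1\<close> of them can be matched with the indices
  \<open>0, \<dots>, n\<close> in such a way that each hyperplane has a finite coefficient at its index
  (\<open>general_position_imp_matching\<close>): if there were no such matching, the tropical minors of a
  largest partial matching would be a common point of these hyperplanes, by a tropical version of
  Cramer's rule (\<open>matching_or_common_zero\<close>). In particular, for each index \<open>i\<close> at most \<open>n\<close>
  hyperplanes have the coefficient \<open>-\<infinity>\<close> at \<open>i\<close>. At a point where \<open>f\<^sub>i = u\<close>, the Weil functions of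
  all the others are \<open>O(1)\<close>, so only \<open>n + 1\<close> of the hyperplanes matter, and the matching shows that
  their Weil functions sum to at most \<open>\<Sum>\<^sub>i (u - f\<^sub>i) + O(1)\<close> (\<open>sum_weil_fun_le\<close>). For at most \<open>n\<close>
  hyperplanes, one finite coefficient of each gives a similar bound with at most \<open>n\<close> summands.

  Tropical entire functions are convex, so \<open>f\<^sub>i r + f\<^sub>i (- r) \<ge> 2 f\<^sub>i 0\<close>, and the average of each summand
  \<open>u - f\<^sub>i\<close> over \<open>r\<close> and \<open>- r\<close> is at most \<open>T r + O(1)\<close>. Nondegeneracy excludes constant curves, and
  for a nonconstant curve convexity makes \<open>T\<close> tend to infinity. Hence each summand contributes at
  most \<open>1\<close> to the sum of the defects, and the bounded terms contribute nothing
  (\<open>sum_defect_le\<close>). If all coefficients are finite, the Weil function itself is bounded, because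
  one may choose an index with \<open>f\<^sub>i = u\<close>; so the defect is \<open>0\<close>.
\<close>

section \<open>Tropical entire functions are convex\<close>

text \<open>
  Subtract a chord from \<open>g\<close>. If the difference were positive somewhere between the ends of the
  chord, it would have a leftmost maximum point \<open>p\<close>, in the interior. The midpoint inequality around
  \<open>p\<close> then forces the maximum to be attained also to the left of \<open>p\<close>.
\<close>

lemma locally_midpoint_convex_imp_convex_on:
  fixes g :: "real \<Rightarrow> real"
  assumes cont: "continuous_on UNIV g"
    and loc: "\<And>p. \<exists>d>0. \<forall>h. 0 < h \<and> h < d \<longrightarrow> 2 * g p \<le> g (p - h) + g (p + h)"
  shows "convex_on UNIV g"
proof (rule convex_on_linorderI)
  fix t x y :: real
  assume t: "0 < t" "t < 1" and "x < y"
  define s where "s = (g y - g x) / (y - x)"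
  define k where "k z = g z - (g x + s * (z - x))" for z
  have k_ends: "k x = 0" "k y = 0"
    using \<open>x < y\<close> by (auto simp: k_def s_def)
  have k_cont: "continuous_on A k" for A
    unfolding k_def by (intro continuous_intros continuous_on_subset[OF cont]) auto
  have k_mid: "k z \<le> 0" if "z \<in> {x..y}" for z
  proof (rule ccontr)
    assume "\<not> k z \<le> 0"
    obtain m where m: "m \<in> {x..y}" "\<And>w. w \<in> {x..y} \<Longrightarrow> k w \<le> k m"
      using continuous_attains_sup[OF compact_Icc _ k_cont, of x y] \<open>x < y\<close> by force
    have "closed {w \<in> {x..y}. k w = k m}"
      by (rule continuous_closed_preimage_constant[OF k_cont closed_atLeastAtMost])
    then have "compact {w \<in> {x..y}. k w = k m}"
      by (auto simp: compact_eq_bounded_closed intro: bounded_subset[OF bounded_closed_interval])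
    then obtain p where p: "p \<in> {x..y}" "k p = k m"
      and p_min: "\<And>w. w \<in> {x..y} \<Longrightarrow> k w = k m \<Longrightarrow> p \<le> w"
      using compact_attains_inf[of "{w \<in> {x..y}. k w = k m}"] m by blast
    have "k m > 0" using m(2)[OF that] \<open>\<not> k z \<le> 0\<close> by simp
    then have "x < p" "p < y" using p k_ends by (auto simp: less_le)
    obtain d where d: "d > 0" "\<And>h. 0 < h \<Longrightarrow> h < d \<Longrightarrow> 2 * g p \<le> g (p - h) + g (p + h)"
      using loc[of p] by blast
    define h where "h = Min {d / 2, p - x, y - p}"
    have h: "0 < h" "h < d" "h \<le> p - x" "h \<le> y - p"
      using d(1) \<open>x < p\<close> \<open>p < y\<close> by (auto simp: h_def)
    have "2 * k p \<le> k (p - h) + k (p + h)"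
      using d(2)[OF h(1,2)] by (simp add: k_def algebra_simps)
    moreover have "k (p - h) \<le> k m" "k (p + h) \<le> k m"
      using h \<open>x < p\<close> \<open>p < y\<close> by (auto intro!: m(2))
    ultimately have "k (p - h) = k m" using p by linarith
    then show False using p_min[of "p - h"] h p by auto
  qed
  have "(1 - t) * x + t * y \<in> {x..y}"
  proof -
    have "(1 - t) * x + t * y = x + t * (y - x)" "(1 - t) * x + t * y = y - (1 - t) * (y - x)"
      by (simp_all add: algebra_simps)
    moreover have "t * (y - x) \<ge> 0" "(1 - t) * (y - x) \<ge> 0" using t \<open>x < y\<close> by simp_all
    ultimately show ?thesis by auto
  qed
  from k_mid[OF this] have "g ((1 - t) * x + t * y) \<le> g x + s * (t * (y - x))"
    by (simp add: k_def algebra_simps)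
  also have "s * (t * (y - x)) = t * (g y - g x)"
    using \<open>x < y\<close> by (simp add: s_def)
  finally show "g ((1 - t) *\<^sub>R x + t *\<^sub>R y) \<le> (1 - t) * g x + t * g y"
    by (simp add: algebra_simps)
qed simp

lemma deriv_affine_on_interval:
  assumes "\<And>z. z \<in> {a<..<b} \<Longrightarrow> g z = s * z + c" "x \<in> {a<..<b::real}"
  shows "deriv g x = (s::real)"
proof (rule DERIV_imp_deriv)
  have "((\<lambda>z. s * z + c) has_real_derivative s) (at x)"
    by (auto intro!: derivative_eq_intros)
  then show "(g has_real_derivative s) (at x)"
    by (rule has_field_derivative_transform_within_open[where S = "{a<..<b}"]) (use assms in auto)
qed

text \<open>
  Near each point \<open>p\<close> the function is affine on both sides, and \<open>trop_omega g p\<close> is the difference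
  of the two slopes. That \<open>p\<close> is not a pole says exactly that \<open>g\<close> is convex near \<open>p\<close>.
\<close>

lemma trop_entire_convex_on:
  assumes "trop_entire g"
  shows "convex_on UNIV g"
proof (rule locally_midpoint_convex_imp_convex_on)
  have mero: "trop_meromorphic g" and no_pole: "\<And>x. trop_omega g x \<ge> 0"
    using assms by (auto simp: trop_entire_def not_less)
  show cont: "continuous_on UNIV g" using mero by (simp add: trop_meromorphic_def)
  fix p
  have "finite {x \<in> {p - 1..p + 1}. \<not> g differentiable (at x)}"
    using mero by (simp add: trop_meromorphic_def)
  from finite_set_avoid[OF this, of p] obtain e where e: "e > 0"
    "\<And>x. x \<in> {p - 1..p + 1} \<Longrightarrow> \<not> g differentiable (at x) \<Longrightarrow> x \<noteq> p \<Longrightarrow> e \<le> dist p x"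
    by blast
  define d where "d = min e 1"
  have d: "d > 0" using e by (simp add: d_def)
  have diff: "g differentiable (at x)" if "\<bar>x - p\<bar> < d" "x \<noteq> p" for x
    using e(2)[of x] that by (force simp: d_def dist_real_def abs_less_iff)
  have affine: "\<exists>s c. \<forall>x\<in>{a<..<b}. g x = s * x + c"
    if "\<forall>x\<in>{a<..<b}. g differentiable (at x)" for a b
    using mero that by (simp add: trop_meromorphic_def)
  have "\<exists>s c. \<forall>x\<in>{p - d<..<p}. g x = s * x + c"
    by (rule affine) (auto intro!: diff)
  then obtain s1 c1 where left: "\<And>x. x \<in> {p - d<..<p} \<Longrightarrow> g x = s1 * x + c1" by blast
  have "\<exists>s c. \<forall>x\<in>{p<..<p + d}. g x = s * x + c"
    by (rule affine) (auto intro!: diff)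
  then obtain s2 c2 where right: "\<And>x. x \<in> {p<..<p + d} \<Longrightarrow> g x = s2 * x + c2" by blast
  have g_tendsto: "(g \<longlongrightarrow> g p) (at p within S)" for S
    using cont by (meson UNIV_I continuous_on_def tendsto_within_subset top_greatest)
  have "(g \<longlongrightarrow> s2 * p + c2) (at_right p)"
  proof (rule Lim_transform_eventually)
    show "((\<lambda>x. s2 * x + c2) \<longlongrightarrow> s2 * p + c2) (at_right p)" by (intro tendsto_intros)
    show "\<forall>\<^sub>F x in at_right p. s2 * x + c2 = g x"
      using d by (auto simp: eventually_at_right[of p "p + d"] right intro!: exI[of _ "p + d"])
  qed
  with g_tendsto have gp2: "g p = s2 * p + c2"
    by (meson tendsto_unique trivial_limit_at_right_real)
  have "(g \<longlongrightarrow> s1 * p + c1) (at_left p)"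
  proof (rule Lim_transform_eventually)
    show "((\<lambda>x. s1 * x + c1) \<longlongrightarrow> s1 * p + c1) (at_left p)" by (intro tendsto_intros)
    show "\<forall>\<^sub>F x in at_left p. s1 * x + c1 = g x"
      using d by (auto simp: eventually_at_left[of "p - d" p] left intro!: exI[of _ "p - d"])
  qed
  with g_tendsto have gp1: "g p = s1 * p + c1"
    by (meson tendsto_unique trivial_limit_at_left_real)
  have "trop_omega g p = s2 - s1"
    unfolding trop_omega_def
  proof (rule tendsto_Lim)
    have "\<forall>\<^sub>F e in at_right 0. deriv g (p + e) - deriv g (p - e) = s2 - s1"
      unfolding eventually_at_right_field
    proof (intro exI[of _ d] conjI d allI impI)
      fix e :: real assume "0 < e" "e < d"
      then show "deriv g (p + e) - deriv g (p - e) = s2 - s1"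
        using deriv_affine_on_interval[of p "p + d" g s2 c2 "p + e"] right
          deriv_affine_on_interval[of "p - d" p g s1 c1 "p - e"] left by simp
    qed
    then show "((\<lambda>e. deriv g (p + e) - deriv g (p - e)) \<longlongrightarrow> s2 - s1) (at_right 0)"
      by (rule tendsto_eventually)
  qed simp
  with no_pole[of p] have "s1 \<le> s2" by simp
  show "\<exists>d>0. \<forall>h. 0 < h \<and> h < d \<longrightarrow> 2 * g p \<le> g (p - h) + g (p + h)"
  proof (intro exI[of _ d] conjI d allI impI)
    fix h assume "0 < h \<and> h < d"
    then have h: "0 < h" "h < d" by auto
    have "g (p - h) = g p - s1 * h" using left[of "p - h"] h gp1 by (simp add: algebra_simps)
    moreover have "g (p + h) = g p + s2 * h"
      using right[of "p + h"] h gp2 by (simp add: algebra_simps)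
    moreover have "s1 * h \<le> s2 * h" using \<open>s1 \<le> s2\<close> h by simp
    ultimately show "2 * g p \<le> g (p - h) + g (p + h)" by linarith
  qed
qed

lemma reduced_representation_convex_on:
  assumes "reduced_representation n f" "i \<le> n"
  shows "convex_on UNIV (f i)"
  using assms by (auto simp: reduced_representation_def intro: trop_entire_convex_on)

section \<open>Growth of the characteristic function\<close>

lemma max_coord_ge: "i \<le> n \<Longrightarrow> v i \<le> max_coord n v"
  by (simp add: max_coord_def)

lemma max_coord_le_iff: "max_coord n v \<le> c \<longleftrightarrow> (\<forall>i\<le>n. v i \<le> c)"
  by (auto simp: max_coord_def)

lemma max_coord_attained: obtains i where "i \<le> n" "max_coord n v = v i"
  using Max_in[of "v ` {..n}"] unfolding max_coord_def by fastforce

lemma convex_on_curve_norm: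
  assumes "reduced_representation n f"
  shows "convex_on UNIV (curve_norm n f)"
proof (rule convex_onI)
  fix t x y :: real assume t: "0 < t" "t < 1"
  show "curve_norm n f ((1 - t) *\<^sub>R x + t *\<^sub>R y) \<le> (1 - t) * curve_norm n f x + t * curve_norm n f y"
    unfolding curve_norm_def max_coord_le_iff
  proof (intro allI impI)
    fix i assume i: "i \<le> n"
    have "f i ((1 - t) *\<^sub>R x + t *\<^sub>R y) \<le> (1 - t) * f i x + t * f i y"
      using t by (intro convex_onD[OF reduced_representation_convex_on[OF assms i]]) auto
    also have "\<dots> \<le> (1 - t) * max_coord n (\<lambda>i. f i x) + t * max_coord n (\<lambda>i. f i y)"
      using t i by (intro add_mono mult_left_mono max_coord_ge[of i n "\<lambda>i. f i _"]) auto
    finally show "f i ((1 - t) *\<^sub>R x + t *\<^sub>R y) \<le> \<dots>" .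
  qed
qed simp

lemma convex_on_UNIV_above_secant:
  fixes g :: "real \<Rightarrow> real"
  assumes "convex_on UNIV g" "t \<ge> 1"
  shows "t * (g y - g x) \<le> g (x + t * (y - x)) - g x"
proof -
  have "g ((1 - 1/t) *\<^sub>R x + (1/t) *\<^sub>R (x + t * (y - x)))
      \<le> (1 - 1/t) * g x + (1/t) * g (x + t * (y - x))"
    using assms by (intro convex_onD) auto
  also have "(1 - 1/t) *\<^sub>R x + (1/t) *\<^sub>R (x + t * (y - x)) = y"
    using assms(2) by (simp add: field_simps)
  finally have "t * g y \<le> t * ((1 - 1/t) * g x + (1/t) * g (x + t * (y - x)))"
    using assms(2) by (intro mult_left_mono) auto
  also have "\<dots> = (t - 1) * g x + g (x + t * (y - x))"
    using assms(2) by (simp add: field_simps)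
  finally show ?thesis by (simp add: algebra_simps)
qed

lemma convex_on_UNIV_bounded_above_imp_constant:
  fixes g :: "real \<Rightarrow> real"
  assumes "convex_on UNIV g" and bdd: "\<And>x. g x \<le> B"
  shows "g x = g y"
proof -
  have "\<not> g x < g y" for x y
  proof
    assume "g x < g y"
    then obtain N :: nat where "real N * (g y - g x) > B - g x"
      using reals_Archimedean3[of "g y - g x"] by auto
    moreover have "real (Suc N) * (g y - g x) \<le> B - g x"
      using convex_on_UNIV_above_secant[OF assms(1), of "real (Suc N)" y x]
        bdd[of "x + real (Suc N) * (y - x)"] by simp
    moreover have "real N * (g y - g x) \<le> real (Suc N) * (g y - g x)"
      using \<open>g x < g y\<close> by (intro mult_right_mono) auto
    ultimately show False by linarith
  qed
  then show ?thesis by (meson linorder_neqE_linordered_idom)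
qed

text \<open>
  Otherwise the curve lies in the hyperplane where \<open>x\<^sub>0 - f\<^sub>0 0\<close> and \<open>x\<^sub>1 - f\<^sub>1 0\<close> agree, all other
  coefficients being \<open>-\<infinity>\<close>.
\<close>

lemma trop_nondegenerate_imp_nonconstant:
  assumes "n \<ge> 1" "trop_nondegenerate n f"
  shows "\<exists>x. f 1 x - f 0 x \<noteq> f 1 0 - f 0 0"
proof (rule ccontr)
  assume "\<not> ?thesis"
  then have const: "f 1 x - f 0 x = f 1 0 - f 0 0" for x by blast
  define b :: "nat \<Rightarrow> ereal"
    where "b i = (if i = 0 then ereal (- f 0 0) else if i = 1 then ereal (- f 1 0) else -\<infinity>)" for i
  have "trop_nonzero n b" by (auto simp: trop_nonzero_def b_def)
  moreover have "trop_curve n f x \<in> trop_hyperplane n b" for x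
  proof -
    let ?v = "\<lambda>i\<in>{..n}. ereal (f i x)"
    have "attained_twice n b ?v"
      unfolding attained_twice_iff
      using assms(1) const[of x] by (intro exI[of _ 0] conjI exI[of _ 1]) (auto simp: b_def)
    moreover have "?v \<in> trop_curve n f x"
      unfolding trop_curve_def
      by (rule equiv_class_self[OF equiv_trop_rel]) (auto simp: trop_nonzero_def)
    ultimately show ?thesis
      unfolding trop_hyperplane_def using trop_curve_in_trop_proj by blast
  qed
  ultimately show False using assms(2) unfolding trop_nondegenerate_def by blast
qed

text \<open>
  Since \<open>T 0 = 0\<close>, convexity makes \<open>T\<close> grow at least linearly as soon as one of its values is
  positive. If none is, then for \<open>u = \<parallel>f\<parallel>\<close> the convex function \<open>f\<^sub>i x + u (- x)\<close> is bounded above by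
  \<open>u x + u (- x) \<le> 2 u 0\<close>, hence constant. So all \<open>f\<^sub>i\<close> differ by constants, which contradicts
  nondegeneracy.
\<close>

lemma filterlim_trop_char_at_top:
  assumes "n \<ge> 1" and red: "reduced_representation n f" and "trop_nondegenerate n f"
  shows "filterlim (trop_char n f) at_top at_top"
proof -
  let ?u = "curve_norm n f"
  note u_convex = convex_on_curve_norm[OF red]
  have grow: "t * trop_char n f r \<le> trop_char n f (t * r)" if "t \<ge> 1" for t r
    using convex_on_UNIV_above_secant[OF u_convex that, of r 0]
      convex_on_UNIV_above_secant[OF u_convex that, of "-r" 0]
    by (simp add: trop_char_def field_simps)
  have "\<exists>r. trop_char n f r > 0"
  proof (rule ccontr)
    assume "\<not> ?thesis"
    then have sym: "?u x + ?u (- x) \<le> 2 * ?u 0" for x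
      using not_less[of 0 "trop_char n f x"] by (auto simp: trop_char_def field_simps)
    have const: "f i x + ?u (- x) = f i 0 + ?u 0" if "i \<le> n" for i x
    proof -
      have "convex_on UNIV (\<lambda>x. ?u (- x))"
      proof (rule convex_onI)
        fix t x y :: real assume "0 < t" "t < 1"
        then show "?u (- ((1 - t) *\<^sub>R x + t *\<^sub>R y)) \<le> (1 - t) * ?u (- x) + t * ?u (- y)"
          using convex_onD[OF u_convex, of t "-x" "-y"] by simp
      qed simp
      with reduced_representation_convex_on[OF red that]
      have "convex_on UNIV (\<lambda>x. f i x + ?u (- x))" by (rule convex_on_add)
      moreover have "f i x + ?u (- x) \<le> 2 * ?u 0" for x
        using sym[of x] max_coord_ge[OF that, of "\<lambda>i. f i x"] by (simp add: curve_norm_def)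
      ultimately have "f i x + ?u (- x) = f i 0 + ?u (- 0)"
        by (rule convex_on_UNIV_bounded_above_imp_constant)
      then show ?thesis by simp
    qed
    obtain x where "f 1 x - f 0 x \<noteq> f 1 0 - f 0 0"
      using trop_nondegenerate_imp_nonconstant assms by blast
    with const[of 0 x] const[of 1 x] assms(1) show False by simp
  qed
  then obtain r where r: "trop_char n f r > 0" by blast
  then have r': "trop_char n f \<bar>r\<bar> > 0" by (cases "r \<ge> 0") (auto simp: trop_char_def add.commute)
  then have "\<bar>r\<bar> > 0" by (cases "r = 0") (auto simp: trop_char_def)
  have "filterlim (\<lambda>s. s * (trop_char n f \<bar>r\<bar> / \<bar>r\<bar>)) at_top at_top"
    using r' \<open>\<bar>r\<bar> > 0\<close>
    by (intro filterlim_at_top_mult_tendsto_pos[OF tendsto_const] filterlim_ident) auto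
  moreover have "\<forall>\<^sub>F s in at_top. s * (trop_char n f \<bar>r\<bar> / \<bar>r\<bar>) \<le> trop_char n f s"
    using eventually_ge_at_top[of "\<bar>r\<bar>"]
  proof eventually_elim
    case (elim s)
    then show ?case using grow[of "s / \<bar>r\<bar>" "\<bar>r\<bar>"] \<open>\<bar>r\<bar> > 0\<close> by simp
  qed
  ultimately show ?thesis by (rule filterlim_at_top_mono)
qed

section \<open>Tropical linear systems and general position\<close>

text \<open>
  A tropical Cramer rule. Let \<open>K\<close> be a largest set of rows that can be matched with columns
  through finite entries, and suppose that some row is left over. Let \<open>x i\<close> be the greatest weight
  of a matching of \<open>K\<close> which misses column \<open>i\<close>; since \<open>card K \<le> n\<close>, some \<open>x i\<close> is finite.

  This \<open>x\<close> is a common zero. If all terms \<open>a j i + x i\<close> of a row \<open>j\<close> are \<open>-\<infinity>\<close>, the maximum is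
  attained at every index, and there are at least two. This is the case for each row \<open>j\<close> outside
  \<open>K\<close>, since a finite term would give a matching of \<open>insert j K\<close>. Otherwise let \<open>i\<close> be a column at
  which the maximum is attained, and \<open>\<tau>\<close> an optimal matching missing \<open>i\<close>. Moving \<open>j\<close> from \<open>\<tau> j\<close>
  to \<open>i\<close> yields a matching that misses \<open>\<tau> j\<close>, and it shows that the maximum is also attained at
  \<open>\<tau> j\<close>.
\<close>

lemma matching_or_common_zero:
  fixes a :: "'r \<Rightarrow> nat \<Rightarrow> ereal"
  assumes "n \<ge> 1" "finite M" "card M \<le> Suc n"
    and no_PInf: "\<And>j i. j \<in> M \<Longrightarrow> i \<le> n \<Longrightarrow> a j i \<noteq> \<infinity>"
  obtains (matching) \<pi> where "inj_on \<pi> M" "\<pi> ` M \<subseteq> {..n}" "\<And>j. j \<in> M \<Longrightarrow> a j (\<pi> j) \<noteq> -\<infinity>"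
  | (common_zero) x where "trop_nonzero n x" "\<And>j. j \<in> M \<Longrightarrow> attained_twice n (a j) x"
proof -
  define matches where "matches K \<tau> \<longleftrightarrow> K \<subseteq> M \<and> inj_on \<tau> K \<and> \<tau> ` K \<subseteq> {..n} \<and>
    (\<forall>j\<in>K. a j (\<tau> j) \<noteq> -\<infinity>)" for K \<tau>
  have "\<exists>K. (\<exists>\<tau>. matches K \<tau>) \<and> (\<forall>L. (\<exists>\<tau>. matches L \<tau>) \<longrightarrow> card L \<le> card K)"
  proof (rule ex_has_greatest_nat[where b = "Suc (card M)"])
    show "\<exists>\<tau>. matches {} \<tau>" by (simp add: matches_def)
    show "\<forall>L. (\<exists>\<tau>. matches L \<tau>) \<longrightarrow> card L < Suc (card M)"
      using card_mono[OF \<open>finite M\<close>] by (auto simp: matches_def less_Suc_eq_le)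
  qed
  then obtain K \<pi> where K: "matches K \<pi>" and K_max: "\<And>L \<tau>. matches L \<tau> \<Longrightarrow> card L \<le> card K"
    by blast
  have "K \<subseteq> M" using K by (simp add: matches_def)
  then have "finite K" using \<open>finite M\<close> finite_subset by blast
  show ?thesis
  proof (cases "K = M")
    case True
    with K show ?thesis by (intro matching[of \<pi>]) (auto simp: matches_def)
  next
    case False
    with \<open>K \<subseteq> M\<close> have "K \<subset> M" by blast
    then have "card K < Suc n"
      using psubset_card_mono[OF \<open>finite M\<close>, of K] assms(3) by linarith
    define B where "B i = {\<tau> \<in> K \<rightarrow>\<^sub>E {..n}. inj_on \<tau> K \<and> i \<notin> \<tau> ` K}" for i
    define w where "w \<tau> = (\<Sum>k\<in>K. a k (\<tau> k))" for \<tau>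
    define x where "x i = (SUP \<tau>\<in>B i. w \<tau>)" for i
    have B_fin: "finite (B i)" for i
      using finite_PiE[of K "\<lambda>_. {..n}"] \<open>finite K\<close> by (simp add: B_def)
    have w_le: "w \<tau> \<le> x i" if "\<tau> \<in> B i" for \<tau> i
      unfolding x_def using that by (rule SUP_upper)
    have x_attained: "\<exists>\<tau>\<in>B i. x i = w \<tau>" if "x i \<noteq> -\<infinity>" for i
    proof -
      have "B i \<noteq> {}" using that by (auto simp: x_def bot_ereal_def)
      then have "x i = Max (w ` B i)" unfolding x_def using B_fin by (simp add: Max_Sup)
      also have "\<dots> \<in> w ` B i" using \<open>B i \<noteq> {}\<close> B_fin by (intro Max_in) auto
      finally show ?thesis by blast
    qed
    have w_PInf: "w \<tau> \<noteq> \<infinity>" if "\<tau> \<in> B i" for \<tau> i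
      using that no_PInf \<open>K \<subseteq> M\<close> by (auto simp: w_def sum_Pinfty B_def PiE_iff subset_iff)
    have x_PInf: "x i \<noteq> \<infinity>" for i
      using x_attained[of i] w_PInf[of _ i] by force
    have "trop_nonzero n x"
      unfolding trop_nonzero_def
    proof (intro conjI allI impI)
      have "card (\<pi> ` K) < card {..n}"
        using \<open>card K < Suc n\<close> card_image_le[OF \<open>finite K\<close>, of \<pi>] by simp
      then have "\<not> {..n} \<subseteq> \<pi> ` K"
        using card_mono[of "\<pi> ` K" "{..n}"] \<open>finite K\<close> by auto
      then obtain l where l: "l \<le> n" "l \<notin> \<pi> ` K" by auto
      have "restrict \<pi> K \<in> B l"
        using K l by (auto simp: B_def matches_def inj_on_def)
      moreover have "w (restrict \<pi> K) \<noteq> -\<infinity>"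
      proof -
        have "w (restrict \<pi> K) = (\<Sum>k\<in>K. ereal (real_of_ereal (a k (\<pi> k))))"
          unfolding w_def using K no_PInf \<open>K \<subseteq> M\<close>
          by (intro sum.cong refl) (auto simp: matches_def ereal_real subset_iff)
        then show ?thesis by simp
      qed
      ultimately have "x l \<noteq> -\<infinity>" using w_le by fastforce
      with l show "\<exists>i\<le>n. x i \<noteq> -\<infinity>" by blast
    qed (rule x_PInf)
    moreover have "attained_twice n (a j) x" if "j \<in> M" for j
    proof -
      obtain i where i: "i \<le> n" "max_coord n (\<lambda>k. a j k + x k) = a j i + x i"
        using max_coord_attained[of n "\<lambda>k. a j k + x k"] by blast
      have i_max: "a j k + x k \<le> a j i + x i" if "k \<le> n" for k
        using max_coord_ge[OF that, of "\<lambda>k. a j k + x k"] i(2) by simp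
      have "\<exists>i'\<le>n. i' \<noteq> i \<and> a j i + x i \<le> a j i' + x i'"
      proof (cases "a j i + x i = -\<infinity>")
        case True
        show ?thesis unfolding True using \<open>n \<ge> 1\<close>
          by (intro exI[of _ "if i = 0 then 1 else 0"]) auto
      next
        case False
        then have fin: "a j i \<noteq> -\<infinity>" "x i \<noteq> -\<infinity>"
          using no_PInf[OF that i(1)] x_PInf[of i] by auto
        obtain \<tau> where \<tau>: "\<tau> \<in> B i" "x i = w \<tau>" using x_attained[OF fin(2)] by blast
        then have \<tau>': "\<tau> \<in> K \<rightarrow>\<^sub>E {..n}" "inj_on \<tau> K" "i \<notin> \<tau> ` K" by (auto simp: B_def)
        \<comment> \<open>All entries used by \<open>\<tau>\<close> are finite, so otherwise \<open>\<tau>(j := i)\<close> would match a larger set.\<close>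
        have "j \<in> K"
        proof (rule ccontr)
          assume "j \<notin> K"
          have "a k (\<tau> k) \<noteq> -\<infinity>" if "k \<in> K" for k
          proof
            assume "a k (\<tau> k) = -\<infinity>"
            moreover have "(\<Sum>k\<in>K - {k}. a k (\<tau> k)) \<noteq> \<infinity>"
              using \<tau>' no_PInf \<open>K \<subseteq> M\<close> by (auto simp: sum_Pinfty PiE_iff subset_iff)
            ultimately have "w \<tau> = -\<infinity>"
              unfolding w_def by (simp add: sum.remove[OF \<open>finite K\<close> \<open>k \<in> K\<close>])
            with fin(2) \<tau>(2) show False by simp
          qed
          then have "matches (insert j K) (\<tau>(j := i))"
            using \<tau>' \<open>j \<notin> K\<close> \<open>j \<in> M\<close> \<open>K \<subseteq> M\<close> i(1) fin(1)
            by (auto simp: matches_def inj_on_def PiE_iff)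
          from K_max[OF this] show False using \<open>finite K\<close> \<open>j \<notin> K\<close> by simp
        qed
        define \<tau>2 where "\<tau>2 = \<tau>(j := i)"
        define c where "c = (\<Sum>k\<in>K - {j}. a k (\<tau> k))"
        have "\<tau>2 \<in> B (\<tau> j)"
          using \<tau>' i(1) \<open>j \<in> K\<close>
          by (auto simp: B_def \<tau>2_def inj_on_def PiE_iff extensional_def)
        have "(\<Sum>k\<in>K - {j}. a k (\<tau>2 k)) = c"
          unfolding c_def by (rule sum.cong) (auto simp: \<tau>2_def)
        then have w2: "w \<tau>2 = a j i + c" and w1: "w \<tau> = a j (\<tau> j) + c"
          unfolding w_def c_def by (simp_all add: sum.remove[OF \<open>finite K\<close> \<open>j \<in> K\<close>] \<tau>2_def)
        have "a j i + x i = a j (\<tau> j) + w \<tau>2"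
          unfolding \<tau>(2) w1 w2 by (simp add: ac_simps)
        also have "\<dots> \<le> a j (\<tau> j) + x (\<tau> j)"
          using w_le[OF \<open>\<tau>2 \<in> B (\<tau> j)\<close>] by (intro add_left_mono)
        finally show ?thesis
          using \<tau>' \<open>j \<in> K\<close> by (intro exI[of _ "\<tau> j"]) (auto simp: PiE_iff)
      qed
      then obtain i' where i': "i' \<le> n" "i' \<noteq> i" "a j i + x i \<le> a j i' + x i'" by blast
      show ?thesis
        unfolding attained_twice_iff using i(1) i' i_max
        by (meson order_trans)
    qed
    ultimately show ?thesis by (rule common_zero)
  qed
qed

text \<open>
  Without a matching the rows would have a common zero, and its class would lie on all the
  hyperplanes.
\<close>

lemma general_position_imp_matching:
  assumes "n \<ge> 1" and gp: "general_position n q (\<lambda>j. trop_hyperplane n (a j))"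
    and nonzero: "\<And>j. j \<in> {1..q} \<Longrightarrow> trop_nonzero n (a j)"
    and M: "M \<subseteq> {1..q}" "card M = Suc n"
  obtains \<pi> where "bij_betw \<pi> M {..n}" "\<And>j. j \<in> M \<Longrightarrow> a j (\<pi> j) \<noteq> -\<infinity>"
proof -
  have "finite M" using M(1) finite_subset by blast
  have no_PInf: "a j i \<noteq> \<infinity>" if "j \<in> M" "i \<le> n" for j i
    using nonzero[of j] that M(1) by (auto simp: trop_nonzero_def)
  show ?thesis
  proof (rule matching_or_common_zero[where a = a, OF assms(1) \<open>finite M\<close> _ no_PInf])
    fix \<pi> assume \<pi>: "inj_on \<pi> M" "\<pi> ` M \<subseteq> {..n}" "\<And>j. j \<in> M \<Longrightarrow> a j (\<pi> j) \<noteq> -\<infinity>"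
    have "\<pi> ` M = {..n}"
      by (rule card_subset_eq) (use \<pi> M in \<open>auto simp: card_image\<close>)
    with \<pi> show thesis by (intro that[of \<pi>]) (auto simp: bij_betw_def)
  next
    fix x assume x: "trop_nonzero n x" "\<And>j. j \<in> M \<Longrightarrow> attained_twice n (a j) x"
    obtain \<mu> where \<mu>: "bij_betw \<mu> {0..n} M"
      using finite_same_card_bij[of "{0..n}" M] \<open>finite M\<close> M(2) by auto
    let ?y = "restrict x {..n}"
    have y: "?y \<in> {x \<in> extensional {..n}. trop_nonzero n x}"
      using x(1) by (auto simp: trop_nonzero_def)
    have "trop_rel n `` {?y} \<in> trop_hyperplane n (a (\<mu> i))" if "i \<in> {0..n}" for i
    proof -
      have "attained_twice n (a (\<mu> i)) x"
        using x(2) \<mu> that by (auto simp: bij_betw_def)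
      then have "attained_twice n (a (\<mu> i)) ?y"
        by (simp add: attained_twice_iff cong: conj_cong)
      moreover have "?y \<in> trop_rel n `` {?y}"
        by (rule equiv_class_self[OF equiv_trop_rel y])
      moreover have "trop_rel n `` {?y} \<in> trop_proj n"
        unfolding trop_proj_def using y by (rule quotientI)
      ultimately show ?thesis unfolding trop_hyperplane_def by blast
    qed
    moreover have "(\<Inter>i\<in>{0..n}. trop_hyperplane n (a (\<mu> i))) = {}"
      using gp \<mu> M(1) unfolding general_position_def bij_betw_def by blast
    ultimately show thesis by blast
  qed (use M in auto)
qed

section \<open>Bounds for Weil functions\<close>

text \<open>
  The sum, rather than the maximum, of the differences between the largest coefficient and the
  finite coefficients: only an upper bound for each of them matters, and the sum needs no case
  distinction.
\<close>

definition coeff_gap :: "nat \<Rightarrow> (nat \<Rightarrow> ereal) \<Rightarrow> real" where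
  "coeff_gap n a =
     (\<Sum>i | i \<le> n \<and> a i \<noteq> -\<infinity>. real_of_ereal (max_coord n a) - real_of_ereal (a i))"

lemma max_coord_finite:
  assumes "trop_nonzero n a"
  shows "\<bar>max_coord n a\<bar> \<noteq> \<infinity>"
proof -
  obtain i where i: "i \<le> n" "a i \<noteq> -\<infinity>" using assms by (auto simp: trop_nonzero_def)
  obtain k where "k \<le> n" "max_coord n a = a k" by (rule max_coord_attained)
  then show ?thesis using assms i max_coord_ge[OF i(1), of a] by (auto simp: trop_nonzero_def)
qed

lemma weil_fun_nonneg:
  assumes "trop_nonzero n a"
  shows "0 \<le> weil_fun n f a x"
proof -
  obtain k where k: "k \<le> n" "trop_linear n a (\<lambda>i. ereal (f i x)) = a k + ereal (f k x)"
    unfolding trop_linear_def using max_coord_attained[of n "\<lambda>i. a i + ereal (f i x)"] by blast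
  have "a k + ereal (f k x) \<le> max_coord n a + ereal (curve_norm n f x)"
    using k(1) max_coord_ge[of k n "\<lambda>i. f i x"]
    by (intro add_mono max_coord_ge) (auto simp: curve_norm_def)
  then show ?thesis
    using max_coord_finite[OF assms] assms k unfolding weil_fun_def k(2) trop_nonzero_def
    by (cases "max_coord n a"; cases "a k") auto
qed

lemma trop_proximity_nonneg:
  assumes "trop_nonzero n a"
  shows "0 \<le> trop_proximity n f a r"
  using weil_fun_nonneg[OF assms] unfolding trop_proximity_def
  by (intro zero_le_divide_ereal add_nonneg_nonneg) auto

lemma weil_fun_le:
  assumes "trop_nonzero n a" "i \<le> n" "a i \<noteq> -\<infinity>"
  shows "weil_fun n f a x \<le> ereal (curve_norm n f x - f i x + coeff_gap n a)"
proof -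
  have fin: "\<bar>a k\<bar> \<noteq> \<infinity>" if "k \<le> n" "a k \<noteq> -\<infinity>" for k
    using assms(1) that by (auto simp: trop_nonzero_def)
  have term_nonneg: "0 \<le> real_of_ereal (max_coord n a) - real_of_ereal (a k)"
    if "k \<le> n" "a k \<noteq> -\<infinity>" for k
    using max_coord_ge[OF that(1), of a] max_coord_finite[OF assms(1)] fin[OF that]
    by (cases "max_coord n a"; cases "a k") auto
  have gap: "real_of_ereal (max_coord n a) - real_of_ereal (a i) \<le> coeff_gap n a"
    unfolding coeff_gap_def using assms term_nonneg by (intro member_le_sum) auto
  have "a i + ereal (f i x) \<le> trop_linear n a (\<lambda>i. ereal (f i x))"
    unfolding trop_linear_def using assms(2) by (rule max_coord_ge)
  then show ?thesis
    using gap max_coord_finite[OF assms(1)] fin[OF assms(2,3)] unfolding weil_fun_def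
    by (cases "max_coord n a"; cases "a i"; cases "trop_linear n a (\<lambda>i. ereal (f i x))") auto
qed

text \<open>
  Fix \<open>x\<close> and an index \<open>i\<close> with \<open>f\<^sub>i x = \<parallel>f x\<parallel>\<close>. If a hyperplane has a finite coefficient at
  \<open>i\<close>, its Weil function at \<open>x\<close> is at most its gap. At most \<open>n\<close> hyperplanes have \<open>-\<infinity>\<close> there,
  because in any \<open>n + 1\<close> hyperplanes a matching assigns \<open>i\<close> to one with a finite coefficient at \<open>i\<close>.
  Enlarge this exceptional family to a set \<open>M\<close> of \<open>n + 1\<close> hyperplanes, and bound the Weil functions
  of its members at the indices given by a matching of \<open>M\<close>; these run once through \<open>0, \<dots>, n\<close>.
\<close>

lemma sum_weil_fun_le:
  assumes "n \<ge> 1" and gp: "general_position n q (\<lambda>j. trop_hyperplane n (a j))"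
    and nonzero: "\<And>j. j \<in> {1..q} \<Longrightarrow> trop_nonzero n (a j)"
    and "Suc n \<le> q"
  shows "(\<Sum>j=1..q. weil_fun n f (a j) x)
    \<le> ereal ((\<Sum>i\<le>n. curve_norm n f x - f i x) + (\<Sum>j=1..q. coeff_gap n (a j)))"
proof -
  obtain i where i: "i \<le> n" "curve_norm n f x = f i x"
    unfolding curve_norm_def using max_coord_attained[of n "\<lambda>i. f i x"] by blast
  define J where "J = {j \<in> {1..q}. a j i = -\<infinity>}"
  have "card J \<le> n"
  proof (rule ccontr)
    assume "\<not> card J \<le> n"
    then obtain M where M: "M \<subseteq> J" "card M = Suc n"
      using obtain_subset_with_card_n[of "Suc n" J] by (metis not_less_eq_eq)
    moreover have "M \<subseteq> {1..q}" using M(1) by (auto simp: J_def)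
    ultimately obtain \<pi> where \<pi>: "bij_betw \<pi> M {..n}" "\<And>j. j \<in> M \<Longrightarrow> a j (\<pi> j) \<noteq> -\<infinity>"
      using general_position_imp_matching[OF assms(1) gp nonzero] by metis
    then obtain j where "j \<in> M" "\<pi> j = i"
      using i(1) unfolding bij_betw_def by (metis atMost_iff imageE)
    with \<pi>(2) M(1) show False by (auto simp: J_def)
  qed
  moreover have "J \<subseteq> {1..q}" by (auto simp: J_def)
  ultimately have "\<exists>M. J \<subseteq> M \<and> M \<subseteq> {1..q} \<and> card M = Suc n"
    using assms(4) by (intro exists_subset_between) auto
  then obtain M where M: "J \<subseteq> M" "M \<subseteq> {1..q}" "card M = Suc n" by blast
  obtain \<pi> where \<pi>: "bij_betw \<pi> M {..n}" "\<And>j. j \<in> M \<Longrightarrow> a j (\<pi> j) \<noteq> -\<infinity>"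
    using general_position_imp_matching[OF assms(1) gp nonzero M(2,3)] by metis
  define \<rho> where "\<rho> j = (if j \<in> M then \<pi> j else i)" for j
  have "weil_fun n f (a j) x \<le> ereal (curve_norm n f x - f (\<rho> j) x + coeff_gap n (a j))"
    if "j \<in> {1..q}" for j
    using \<pi> M(1) that i(1) by (intro weil_fun_le nonzero) (auto simp: \<rho>_def bij_betw_def J_def)
  then have "(\<Sum>j=1..q. weil_fun n f (a j) x)
      \<le> (\<Sum>j=1..q. ereal (curve_norm n f x - f (\<rho> j) x + coeff_gap n (a j)))"
    by (rule sum_mono)
  also have "\<dots> = ereal ((\<Sum>j=1..q. curve_norm n f x - f (\<rho> j) x) + (\<Sum>j=1..q. coeff_gap n (a j)))"
    by (simp add: sum.distrib)
  also have "(\<Sum>j=1..q. curve_norm n f x - f (\<rho> j) x) = (\<Sum>j\<in>M. curve_norm n f x - f (\<pi> j) x)"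
    using M(2) i(2) by (intro sum.mono_neutral_cong_right) (auto simp: \<rho>_def)
  also have "\<dots> = (\<Sum>i\<le>n. curve_norm n f x - f i x)"
    by (rule sum.reindex_bij_betw[OF \<pi>(1)])
  finally show ?thesis .
qed

section \<open>From Weil functions to defects\<close>

lemma Liminf_sum_le:
  fixes g :: "'i \<Rightarrow> 'a \<Rightarrow> ereal"
  assumes "F \<noteq> bot" "finite Q" "\<And>j. j \<in> Q \<Longrightarrow> \<forall>\<^sub>F x in F. 0 \<le> g j x"
  shows "(\<Sum>j\<in>Q. Liminf F (g j)) \<le> Liminf F (\<lambda>x. \<Sum>j\<in>Q. g j x)"
  using assms(2,3)
proof (induction rule: finite_induct)
  case empty
  then show ?case using assms(1) by (simp add: Liminf_const)
next
  case (insert j Q)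
  have "\<forall>\<^sub>F x in F. \<forall>k\<in>Q. 0 \<le> g k x"
    using insert by (simp add: eventually_ball_finite)
  then have "\<forall>\<^sub>F x in F. 0 \<le> (\<Sum>k\<in>Q. g k x)"
    by (rule eventually_mono) (simp add: sum_nonneg)
  then have "Liminf F (g j) + Liminf F (\<lambda>x. \<Sum>k\<in>Q. g k x)
      \<le> Liminf F (\<lambda>x. g j x + (\<Sum>k\<in>Q. g k x))"
    using insert.prems by (intro Liminf_add_le assms(1)) auto
  moreover have "(\<Sum>k\<in>Q. Liminf F (g k)) \<le> Liminf F (\<lambda>x. \<Sum>k\<in>Q. g k x)"
    using insert by auto
  ultimately show ?case
    using insert.hyps by (simp add: order_trans[OF add_left_mono])
qed

context
  fixes n :: nat and f :: "nat \<Rightarrow> real \<Rightarrow> real"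
  assumes n: "n \<ge> 1" and red: "reduced_representation n f" and nondeg: "trop_nondegenerate n f"
begin

lemma eventually_trop_char_pos: "\<forall>\<^sub>F r in at_top. 0 < trop_char n f r"
  using filterlim_trop_char_at_top[OF n red nondeg] by (simp add: filterlim_at_top_dense)

lemma eventually_proximity_ratio_nonneg:
  assumes "trop_nonzero n a"
  shows "\<forall>\<^sub>F r in at_top. 0 \<le> trop_proximity n f a r / ereal (trop_char n f r)"
  using eventually_trop_char_pos
  by eventually_elim (simp add: trop_proximity_nonneg[OF assms] zero_le_divide_ereal)

lemma trop_defect_nonneg:
  assumes "trop_nonzero n a"
  shows "0 \<le> trop_defect n f a"
  unfolding trop_defect_def by (intro Liminf_bounded eventually_proximity_ratio_nonneg assms)

text \<open>
  Averaging over \<open>r\<close> and \<open>- r\<close> turns each summand \<open>\<parallel>f\<parallel> - f\<^sub>i\<close> into at most \<open>T r + O(1)\<close>, by convexity of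
  \<open>f\<^sub>i\<close>; division by \<open>T r\<close>, which tends to infinity, leaves one unit for each summand. Indices may
  be repeated by \<open>\<iota>\<close>, as needed for few hyperplanes, and \<open>K\<close> may be empty, which is the case of
  bounded Weil functions.
\<close>

lemma sum_defect_le:
  assumes "finite Q" "finite K" and nonzero: "\<And>j. j \<in> Q \<Longrightarrow> trop_nonzero n (a j)"
    and \<iota>: "\<And>k. k \<in> K \<Longrightarrow> \<iota> k \<le> n"
    and le: "\<And>x. (\<Sum>j\<in>Q. weil_fun n f (a j) x)
        \<le> ereal ((\<Sum>k\<in>K. curve_norm n f x - f (\<iota> k) x) + C)"
  shows "(\<Sum>j\<in>Q. trop_defect n f (a j)) \<le> ereal (real (card K))"
proof -
  define D where "D = (\<Sum>k\<in>K. curve_norm n f 0 - f (\<iota> k) 0) + C"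
  have prox: "(\<Sum>j\<in>Q. trop_proximity n f (a j) r) \<le> ereal (card K * trop_char n f r + D)" for r
  proof -
    let ?S = "\<lambda>x. \<Sum>k\<in>K. curve_norm n f x - f (\<iota> k) x"
    have jensen: "2 * f (\<iota> k) 0 \<le> f (\<iota> k) r + f (\<iota> k) (- r)" if "k \<in> K" for k
      using convex_onD[OF reduced_representation_convex_on[OF red \<iota>[OF that]], of "1/2" r "-r"]
      by simp
    have "(\<Sum>j\<in>Q. trop_proximity n f (a j) r)
        = ((\<Sum>j\<in>Q. weil_fun n f (a j) r) + (\<Sum>j\<in>Q. weil_fun n f (a j) (- r))) / 2"
      unfolding trop_proximity_def divide_ereal_def sum.distrib[symmetric]
      by (rule sum_ereal_left_distrib[symmetric]) (simp add: nonzero weil_fun_nonneg)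
    also have "\<dots> \<le> (ereal (?S r + C) + ereal (?S (- r) + C)) / 2"
      by (intro ereal_divide_right_mono add_mono le) simp
    also have "\<dots> = ereal ((\<Sum>k\<in>K. (curve_norm n f r - f (\<iota> k) r
        + (curve_norm n f (- r) - f (\<iota> k) (- r))) / 2) + C)"
      by (simp add: sum.distrib flip: sum_divide_distrib)
    also have "\<dots> \<le> ereal ((\<Sum>k\<in>K. trop_char n f r + (curve_norm n f 0 - f (\<iota> k) 0)) + C)"
      unfolding ereal_less_eq
      by (intro add_right_mono sum_mono, drule jensen) (simp add: trop_char_def field_simps)
    also have "\<dots> = ereal (card K * trop_char n f r + D)"
      by (simp add: D_def sum.distrib)
    finally show ?thesis .
  qed
  have "(\<Sum>j\<in>Q. trop_defect n f (a j))
      \<le> Liminf at_top (\<lambda>r. \<Sum>j\<in>Q. trop_proximity n f (a j) r / ereal (trop_char n f r))"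
    unfolding trop_defect_def
    by (intro Liminf_sum_le assms(1) eventually_proximity_ratio_nonneg nonzero) auto
  also have "\<dots> \<le> Liminf at_top (\<lambda>r. ereal (card K + D / trop_char n f r))"
    using eventually_trop_char_pos
  proof (intro Liminf_mono, eventually_elim)
    case (elim r)
    have "(\<Sum>j\<in>Q. trop_proximity n f (a j) r / ereal (trop_char n f r))
        = (\<Sum>j\<in>Q. trop_proximity n f (a j) r) / ereal (trop_char n f r)"
      unfolding divide_ereal_def
      by (rule sum_ereal_left_distrib[symmetric]) (simp add: nonzero trop_proximity_nonneg)
    also have "\<dots> \<le> ereal (card K * trop_char n f r + D) / ereal (trop_char n f r)"
      using elim by (intro ereal_divide_right_mono prox) simp
    also have "\<dots> = ereal (card K + D / trop_char n f r)"
      using elim by (simp add: field_simps)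
    finally show ?case .
  qed
  also have "\<dots> = ereal (real (card K) + 0)"
  proof (rule lim_imp_Liminf)
    have "((\<lambda>r. D / trop_char n f r) \<longlongrightarrow> 0) at_top"
      using filterlim_trop_char_at_top[OF n red nondeg]
      by (intro tendsto_divide_0[OF tendsto_const] filterlim_at_top_imp_at_infinity)
    then show "((\<lambda>r. ereal (card K + D / trop_char n f r)) \<longlongrightarrow> ereal (real (card K) + 0)) at_top"
      by (intro tendsto_intros)
  qed simp
  finally show ?thesis by simp
qed

end

theorem theorem1p12:
  fixes n q :: nat and f :: "nat \<Rightarrow> real \<Rightarrow> real" and a :: "nat \<Rightarrow> nat \<Rightarrow> ereal"
  assumes "n \<ge> 1"
    and "reduced_representation n f"
    and "trop_nondegenerate n f"
    and "\<And>j. j \<in> {1..q} \<Longrightarrow> trop_nonzero n (a j)"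
    and "general_position n q (\<lambda>j. trop_hyperplane n (a j))"
  shows "(\<Sum>j=1..q. trop_defect n f (a j)) \<le> ereal (real n + 1) \<and>
    (\<forall>b::nat \<Rightarrow> real. trop_defect n f (\<lambda>i. ereal (b i)) = 0)"
proof (intro conjI allI)
  note sum_defect_le' = sum_defect_le[OF assms(1-3)]
  show "(\<Sum>j=1..q. trop_defect n f (a j)) \<le> ereal (real n + 1)"
  proof (cases "Suc n \<le> q")
    case True
    have "(\<Sum>j=1..q. trop_defect n f (a j)) \<le> ereal (real (card {..n}))"
      by (rule sum_defect_le'[where \<iota> = id])
        (use sum_weil_fun_le[OF assms(1,5,4) True] assms(4) in auto)
    then show ?thesis by (simp add: add.commute)
  next
    case False
    have "\<exists>i\<le>n. a j i \<noteq> -\<infinity>" if "j \<in> {1..q}" for j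
      using assms(4)[OF that] by (simp add: trop_nonzero_def)
    then obtain \<iota> where \<iota>: "\<And>j. j \<in> {1..q} \<Longrightarrow> \<iota> j \<le> n \<and> a j (\<iota> j) \<noteq> -\<infinity>" by metis
    have "(\<Sum>j=1..q. weil_fun n f (a j) x)
        \<le> ereal ((\<Sum>j=1..q. curve_norm n f x - f (\<iota> j) x) + (\<Sum>j=1..q. coeff_gap n (a j)))" for x
    proof -
      have "(\<Sum>j=1..q. weil_fun n f (a j) x)
          \<le> (\<Sum>j=1..q. ereal (curve_norm n f x - f (\<iota> j) x + coeff_gap n (a j)))"
        by (intro sum_mono weil_fun_le assms(4)) (use \<iota> in auto)
      then show ?thesis by (simp add: sum.distrib)
    qed
    then have "(\<Sum>j=1..q. trop_defect n f (a j)) \<le> ereal (real (card {1..q}))"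
      by (intro sum_defect_le'[where \<iota> = \<iota>]) (use \<iota> assms(4) in auto)
    also have "\<dots> \<le> ereal (real n + 1)" using False by simp
    finally show ?thesis .
  qed
  fix b :: "nat \<Rightarrow> real"
  let ?b = "\<lambda>i. ereal (b i)"
  have nonzero: "trop_nonzero n ?b" by (auto simp: trop_nonzero_def)
  have bounded: "weil_fun n f ?b x \<le> ereal (coeff_gap n ?b)" for x
  proof -
    obtain i where "i \<le> n" "curve_norm n f x = f i x"
      unfolding curve_norm_def using max_coord_attained[of n "\<lambda>i. f i x"] by blast
    then show ?thesis using weil_fun_le[OF nonzero, of i f x] by simp
  qed
  have "(\<Sum>j\<in>{0::nat}. trop_defect n f ?b) \<le> ereal (real (card ({} :: nat set)))"
    by (rule sum_defect_le'[where \<iota> = id]) (use nonzero bounded in auto)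
  then show "trop_defect n f ?b = 0"
    using trop_defect_nonneg[OF assms(1-3) nonzero] by (simp add: zero_ereal_def)
qed

end
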